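(* Let $(\mathcal{M},\approx_{\mathcal{I}},Pt_{\mathcal{I}})$ and $(\mathcal{N},\approx_{\mathcal{J}},Pt_{\mathcal{J}})$ be PER-sets. Then the space $[\mathcal{M}\to_{\mathfrak{D}}\mathcal{N}]$ of $\mathfrak{D}$-continuous functions, with index set $\mathcal{I}\times\mathcal{J}$, the relations $\approx_{i\to j}$, the point sets $\mathcal{P}_{i\to j}$ and the maps $Pt_{i\to j}(f)=Pt_j\circ f\circ Pt_i$, is a PER-set.
   Context: Index sets $\mathcal{I},\mathcal{J},\dots$ are non-empty directed preordered sets; $\mathcal{I}\times\mathcal{J}$ carries the product order and its elements are written $i\to j$. For each index set $\mathcal{I}$ (including products) a set $\mathfrak{D}(\mathcal{I})\subseteq\mathcal{P}(\mathcal{I})$ is fixed. Standing assumptions: $\mathfrak{D}(\mathcal{I})$ is a proper filter of subsets of $\mathcal{I}$, all of whose members are cofinal, and it contains all non-empty up-sets; and if $\mathcal{H}\in\mathfrak{D}(\mathcal{I}\times\mathcal{J})$ and $\mathcal{I}'\in\mathfrak{D}(\mathcal{I})$, then $\{j\in\mathcal{J}\mid\exists i\in\mathcal{I}'\ i\to j\in\mathcal{H}\}\in\mathfrak{D}(\mathcal{J})$. For PERs (symmetric, transitive relations) $\approx_i$ on $\mathcal{M}$ put $[i]:=\{a\in\mathcal{M}\mid a\approx_i a\}$, $\mathcal{I}_a:=\{i\in\mathcal{I}\mid a\in[i]\}$. $(\mathcal{M},\approx_{\mathcal{I}})$ is a $\mathfrak{D}$-set iff each $\approx_i$ is a PER;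 $\mathcal{I}_a\in\mathfrak{D}(\mathcal{I})$ for all $a$; and $a\approx_{i'}b$, $a,b\in[i]$ imply $a\approx_i b$ for $i\le i'$. Standing assumption: each $\approx_i$ has only finitely many equivalence classes. A $\mathfrak{D}$-set is pointed, with $pt_{\mathcal{I}}$, iff there are $\mathcal{P}_i\subseteq\mathcal{M}$ and surjective maps $pt_i:[i]\to\mathcal{P}_i$ such that for all $a,b$ and $i\le i'$: $\mathcal{P}_i\subseteq\mathcal{P}_{i'}$; $a\approx_i b$ implies $a\approx_i pt_i(a)=pt_i(b)$; $a\in[i]\cap[i']$ implies $pt_{i'}(a)\in[i]$. A PER-set $(\mathcal{M},\approx_{\mathcal{I}},Pt_{\mathcal{I}})$ is a pointed $\mathfrak{D}$-set with maps $Pt_i:\mathcal{M}\to\mathcal{P}_i$ such that for all $i\le i'$: $Pt_i(a)=pt_i(a)$ for $a\in[i]$ (so $pt_i=Pt_i{\restriction}_{[i]}$); $Pt_i=Pt_i\circ Pt_{i'}$; and $a\in[i]$ implies $Pt_{i'}(a)\in[i]$. Put $a\approx^+_i b:\iff Pt_i(a)=Pt_i(b)$. For $f,g:\mathcal{M}\to\mathcal{N}$ let $f\approx_{i\to j}g:\iff$ ($a\approx_i b$ implies $f(a)\approx_j g(b)$ for all $a,b\in\mathcal{M}$). A function $f:\mathcal{M}\to\mathcal{N}$ is $\mathfrak{D}$-continuous iff $\{i\to j\in\mathcal{I}\times\mathcal{J}\mid f\approx_{i\to j}f\}\in\mathfrak{D}(\mathcal{I}\times\mathcal{J})$; $[\mathcal{M}\to_{\mathfrak{D}}\mathcal{N}]$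 is the set of all $\mathfrak{D}$-continuous functions. The points of the function space are $$f\in\mathcal{P}_{i\to j}:\iff a\approx^+_i b\text{ implies }f(a)=f(b)\in\mathcal{P}_j\text{ for all }a,b\in\mathcal{M}.$$ *)

theory Defs
  imports Main "HOL-Library.FuncSet"
begin

text \<open>
  Index sets and the underlying sets of PER-sets are carrier sets inside a type. Orders and PERs
  are relations contained in the square of their carrier; functions \<open>M \<rightarrow> N\<close> between carriers
  are the extensional ones, \<open>M \<rightarrow>\<^sub>E N\<close>.
\<close>

definition index_set :: "'i set \<Rightarrow> 'i rel \<Rightarrow> bool" where
  "index_set I r \<longleftrightarrow>
     I \<noteq> {} \<and> preorder_on I r \<and> (\<forall>i\<in>I. \<forall>i'\<in>I. \<exists>k\<in>I. (i, k) \<in> r \<and> (i', k) \<in> r)"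

definition prod_order :: "'i rel \<Rightarrow> 'j rel \<Rightarrow> ('i \<times> 'j) rel" where
  "prod_order r s = {((i, j), (i', j')). (i, i') \<in> r \<and> (j, j') \<in> s}"

definition cofinal_in :: "'i set \<Rightarrow> 'i rel \<Rightarrow> 'i set \<Rightarrow> bool" where
  "cofinal_in I r A \<longleftrightarrow> A \<subseteq> I \<and> (\<forall>i\<in>I. \<exists>a\<in>A. (i, a) \<in> r)"

definition up_set :: "'i set \<Rightarrow> 'i rel \<Rightarrow> 'i set \<Rightarrow> bool" where
  "up_set I r U \<longleftrightarrow> U \<subseteq> I \<and> (\<forall>i\<in>U. \<forall>i'\<in>I. (i, i') \<in> r \<longrightarrow> i' \<in> U)"

definition proper_filter_on :: "'i set \<Rightarrow> 'i set set \<Rightarrow> bool" where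
  "proper_filter_on I D \<longleftrightarrow>
     D \<subseteq> Pow I \<and> I \<in> D \<and> {} \<notin> D \<and>
     (\<forall>A\<in>D. \<forall>B\<in>D. A \<inter> B \<in> D) \<and>
     (\<forall>A\<in>D. \<forall>B. A \<subseteq> B \<and> B \<subseteq> I \<longrightarrow> B \<in> D)"

definition D_filter :: "'i set \<Rightarrow> 'i rel \<Rightarrow> 'i set set \<Rightarrow> bool" where
  "D_filter I r D \<longleftrightarrow>
     proper_filter_on I D \<and>
     (\<forall>A\<in>D. cofinal_in I r A) \<and>
     (\<forall>U. up_set I r U \<and> U \<noteq> {} \<longrightarrow> U \<in> D)"

text \<open>
  The assignment of a filter to every index set ranges over index sets of different types, so it
  is represented by its values at \<open>I\<close>, \<open>J\<close> and \<open>I \<times> J\<close>. The following condition relates them.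
\<close>

definition D_projection :: "'i set set \<Rightarrow> 'j set \<Rightarrow> 'j set set \<Rightarrow> ('i \<times> 'j) set set \<Rightarrow> bool" where
  "D_projection DI J DJ DIJ \<longleftrightarrow>
     (\<forall>H\<in>DIJ. \<forall>I'\<in>DI. {j \<in> J. \<exists>i\<in>I'. (i, j) \<in> H} \<in> DJ)"

definition per_dom :: "'a rel \<Rightarrow> 'a set" where
  "per_dom R = {a. (a, a) \<in> R}"

text \<open>
  The standing assumption that every PER has only finitely many equivalence classes is part of
  the definition of a \<open>\<DD>\<close>-set.
\<close>

definition D_set ::
  "'i set \<Rightarrow> 'i rel \<Rightarrow> 'i set set \<Rightarrow> 'a set \<Rightarrow> ('i \<Rightarrow> 'a rel) \<Rightarrow> bool" where
  "D_set I r D M E \<longleftrightarrow>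
     index_set I r \<and>
     (\<forall>i\<in>I. E i \<subseteq> M \<times> M \<and> sym (E i) \<and> trans (E i)) \<and>
     (\<forall>a\<in>M. {i \<in> I. a \<in> per_dom (E i)} \<in> D) \<and>
     (\<forall>i\<in>I. \<forall>i'\<in>I. (i, i') \<in> r \<longrightarrow>
        (\<forall>a b. (a, b) \<in> E i' \<and> a \<in> per_dom (E i) \<and> b \<in> per_dom (E i) \<longrightarrow> (a, b) \<in> E i)) \<and>
     (\<forall>i\<in>I. finite (per_dom (E i) // E i))"

definition pointed_D_set ::
  "'i set \<Rightarrow> 'i rel \<Rightarrow> 'i set set \<Rightarrow> 'a set \<Rightarrow> ('i \<Rightarrow> 'a rel) \<Rightarrow>
   ('i \<Rightarrow> 'a set) \<Rightarrow> ('i \<Rightarrow> 'a \<Rightarrow> 'a) \<Rightarrow> bool" where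
  "pointed_D_set I r D M E P pt \<longleftrightarrow>
     D_set I r D M E \<and>
     (\<forall>i\<in>I. P i \<subseteq> M \<and> pt i ` per_dom (E i) = P i) \<and>
     (\<forall>i\<in>I. \<forall>a b. (a, b) \<in> E i \<longrightarrow> (a, pt i a) \<in> E i \<and> pt i a = pt i b) \<and>
     (\<forall>i\<in>I. \<forall>i'\<in>I. (i, i') \<in> r \<longrightarrow>
        P i \<subseteq> P i' \<and>
        (\<forall>a. a \<in> per_dom (E i) \<inter> per_dom (E i') \<longrightarrow> pt i' a \<in> per_dom (E i)))"

definition PER_set ::
  "'i set \<Rightarrow> 'i rel \<Rightarrow> 'i set set \<Rightarrow> 'a set \<Rightarrow> ('i \<Rightarrow> 'a rel) \<Rightarrow>
   ('i \<Rightarrow> 'a set) \<Rightarrow> ('i \<Rightarrow> 'a \<Rightarrow> 'a) \<Rightarrow> bool" where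
  "PER_set I r D M E P Pt \<longleftrightarrow>
     (\<exists>pt. pointed_D_set I r D M E P pt \<and>
       (\<forall>i\<in>I. Pt i \<in> M \<rightarrow> P i \<and> (\<forall>a\<in>per_dom (E i). Pt i a = pt i a)) \<and>
       (\<forall>i\<in>I. \<forall>i'\<in>I. (i, i') \<in> r \<longrightarrow>
          (\<forall>a\<in>M. Pt i a = Pt i (Pt i' a)) \<and>
          (\<forall>a\<in>per_dom (E i). Pt i' a \<in> per_dom (E i))))"

definition approx_plus :: "'a set \<Rightarrow> ('i \<Rightarrow> 'a \<Rightarrow> 'a) \<Rightarrow> 'i \<Rightarrow> 'a rel" where
  "approx_plus M Pt i = {(a, b). a \<in> M \<and> b \<in> M \<and> Pt i a = Pt i b}"

definition fun_approx ::
  "'a set \<Rightarrow> ('i \<Rightarrow> 'a rel) \<Rightarrow> 'b set \<Rightarrow> ('j \<Rightarrow> 'b rel) \<Rightarrow> 'i \<times> 'j \<Rightarrow> ('a \<Rightarrow> 'b) rel" where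
  "fun_approx M E N F = (\<lambda>(i, j). {(f, g). f \<in> M \<rightarrow>\<^sub>E N \<and> g \<in> M \<rightarrow>\<^sub>E N \<and>
     (\<forall>a\<in>M. \<forall>b\<in>M. (a, b) \<in> E i \<longrightarrow> (f a, g b) \<in> F j)})"

definition D_continuous ::
  "'i set \<Rightarrow> 'j set \<Rightarrow> ('i \<times> 'j) set set \<Rightarrow> 'a set \<Rightarrow> ('i \<Rightarrow> 'a rel) \<Rightarrow>
   'b set \<Rightarrow> ('j \<Rightarrow> 'b rel) \<Rightarrow> ('a \<Rightarrow> 'b) \<Rightarrow> bool" where
  "D_continuous I J DIJ M E N F f \<longleftrightarrow>
     f \<in> M \<rightarrow>\<^sub>E N \<and> {ij \<in> I \<times> J. (f, f) \<in> fun_approx M E N F ij} \<in> DIJ"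

definition D_fun_space ::
  "'i set \<Rightarrow> 'j set \<Rightarrow> ('i \<times> 'j) set set \<Rightarrow> 'a set \<Rightarrow> ('i \<Rightarrow> 'a rel) \<Rightarrow>
   'b set \<Rightarrow> ('j \<Rightarrow> 'b rel) \<Rightarrow> ('a \<Rightarrow> 'b) set" where
  "D_fun_space I J DIJ M E N F = {f. D_continuous I J DIJ M E N F f}"

definition D_fun_approx ::
  "'i set \<Rightarrow> 'j set \<Rightarrow> ('i \<times> 'j) set set \<Rightarrow> 'a set \<Rightarrow> ('i \<Rightarrow> 'a rel) \<Rightarrow>
   'b set \<Rightarrow> ('j \<Rightarrow> 'b rel) \<Rightarrow> 'i \<times> 'j \<Rightarrow> ('a \<Rightarrow> 'b) rel" where
  "D_fun_approx I J DIJ M E N F ij =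
     Restr (fun_approx M E N F ij) (D_fun_space I J DIJ M E N F)"

text \<open>
  Continuity is not built into the points: that every point is \<open>\<DD>\<close>-continuous is part of
  the function space being pointed (\<open>P i \<subseteq> M\<close> in \<open>pointed_D_set\<close>).
\<close>

definition fun_points ::
  "'a set \<Rightarrow> ('i \<Rightarrow> 'a \<Rightarrow> 'a) \<Rightarrow> 'b set \<Rightarrow> ('j \<Rightarrow> 'b set) \<Rightarrow> 'i \<times> 'j \<Rightarrow> ('a \<Rightarrow> 'b) set" where
  "fun_points M Pt N Q = (\<lambda>(i, j). {f \<in> M \<rightarrow>\<^sub>E N.
     \<forall>a\<in>M. \<forall>b\<in>M. (a, b) \<in> approx_plus M Pt i \<longrightarrow> f a = f b \<and> f b \<in> Q j})"

definition fun_Pt ::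
  "'a set \<Rightarrow> ('i \<Rightarrow> 'a \<Rightarrow> 'a) \<Rightarrow> ('j \<Rightarrow> 'b \<Rightarrow> 'b) \<Rightarrow> 'i \<times> 'j \<Rightarrow> ('a \<Rightarrow> 'b) \<Rightarrow> ('a \<Rightarrow> 'b)" where
  "fun_Pt M Pt Qt = (\<lambda>(i, j) f. restrict (Qt j \<circ> f \<circ> Pt i) M)"

end

theory Submission
  imports Defs
begin

text \<open>
  In a PER-set the point \<open>Pt i a\<close> always lies in \<open>[i]\<close>, \<open>Pt i\<close> is a retraction onto the finite set
  \<open>P i\<close>, and two elements of \<open>[i]\<close> are related iff \<open>Pt i\<close> identifies them. A function in
  \<open>[i \<rightarrow> j]\<close> is therefore determined up to \<open>\<approx>\<close> by its values on \<open>P i\<close>, up to \<open>\<approx>\<close> in \<open>N\<close>. Since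
  \<open>P i \<subseteq> P i'\<close> for \<open>i \<le> i'\<close>, this allows one to compare functions at different indices, and it
  leaves only finitely many classes. Points of the function space are continuous because such a
  point at \<open>(i, j)\<close> lies in \<open>[i' \<rightarrow> j']\<close> for all \<open>(i', j')\<close> above \<open>(i, j)\<close>.
\<close>

section \<open>Filters and products of index sets\<close>

lemma D_filterI_up_set:
  assumes "D_filter I r D" "up_set I r U" "U \<noteq> {}" "U \<subseteq> A" "A \<subseteq> I"
  shows "A \<in> D"
  using assms unfolding D_filter_def proper_filter_on_def by blast

lemma index_set_prod:
  assumes "index_set I r" "index_set J s"
  shows "index_set (I \<times> J) (prod_order r s)"
proof -
  have "preorder_on (I \<times> J) (prod_order r s)"
    using assms unfolding index_set_def preorder_on_def
    by (auto simp: prod_order_def refl_on_def trans_def)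
  moreover have "\<exists>k\<in>I \<times> J. (p, k) \<in> prod_order r s \<and> (q, k) \<in> prod_order r s"
    if pq: "p \<in> I \<times> J" "q \<in> I \<times> J" for p q
  proof -
    have "fst p \<in> I" "fst q \<in> I" "snd p \<in> J" "snd q \<in> J"
      using pq by auto
    then obtain k l where "k \<in> I" "(fst p, k) \<in> r" "(fst q, k) \<in> r"
      and "l \<in> J" "(snd p, l) \<in> s" "(snd q, l) \<in> s"
      using assms unfolding index_set_def by blast
    then show ?thesis
      by (intro bexI[of _ "(k, l)"]) (auto simp: prod_order_def split: prod.splits)
  qed
  ultimately show ?thesis
    using assms unfolding index_set_def by auto
qed

section \<open>Elementary theory of a single PER-set\<close>

locale per_set =
  fixes I :: "'i set" and r :: "'i rel" and D :: "'i set set"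
    and M :: "'a set" and E :: "'i \<Rightarrow> 'a rel" and P :: "'i \<Rightarrow> 'a set" and Pt :: "'i \<Rightarrow> 'a \<Rightarrow> 'a"
  assumes PER_set: "PER_set I r D M E P Pt"
begin

lemma D_set: "D_set I r D M E"
  using PER_set unfolding PER_set_def pointed_D_set_def by blast

lemma index_set: "index_set I r"
  using D_set unfolding D_set_def by blast

lemma order_refl: "i \<in> I \<Longrightarrow> (i, i) \<in> r"
  using index_set unfolding index_set_def preorder_on_def refl_on_def by blast

lemma order_trans: "(i, i') \<in> r \<Longrightarrow> (i', i'') \<in> r \<Longrightarrow> (i, i'') \<in> r"
  using index_set unfolding index_set_def preorder_on_def by (meson transE)

lemma rel_carrier:
  assumes "i \<in> I" "(a, b) \<in> E i"
  shows "a \<in> M" "b \<in> M"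
  using D_set assms unfolding D_set_def by blast+

lemma rel_sym: "i \<in> I \<Longrightarrow> (a, b) \<in> E i \<Longrightarrow> (b, a) \<in> E i"
  using D_set unfolding D_set_def by (meson symE)

lemma rel_trans: "i \<in> I \<Longrightarrow> (a, b) \<in> E i \<Longrightarrow> (b, c) \<in> E i \<Longrightarrow> (a, c) \<in> E i"
  using D_set unfolding D_set_def by (meson transE)

lemma rel_refl:
  assumes "i \<in> I" "(a, b) \<in> E i"
  shows "(a, a) \<in> E i" "(b, b) \<in> E i"
  using assms rel_sym rel_trans by blast+

lemma rel_downward:
  assumes "i \<in> I" "i' \<in> I" "(i, i') \<in> r" "(a, b) \<in> E i'" "(a, a) \<in> E i" "(b, b) \<in> E i"
  shows "(a, b) \<in> E i"
  using D_set assms unfolding D_set_def per_dom_def by blast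

text \<open>The definition grants this for the existentially bound \<open>pt\<close>. It passes to
  \<open>Pt\<close> because both elements lie in \<open>[i]\<close>, where the two maps
  agree.\<close>

lemma Pt_eq:
  assumes "i \<in> I" "(a, b) \<in> E i"
  shows "Pt i a = Pt i b"
proof -
  obtain pt where pt: "pointed_D_set I r D M E P pt" "\<forall>a\<in>per_dom (E i). Pt i a = pt i a"
    using PER_set assms(1) unfolding PER_set_def by blast
  have "pt i a = pt i b"
    using pt(1) assms unfolding pointed_D_set_def by blast
  then show ?thesis
    using pt(2) rel_refl[OF assms] by (simp add: per_dom_def)
qed

lemma rel_Pt:
  assumes "i \<in> I" "(a, b) \<in> E i"
  shows "(a, Pt i b) \<in> E i"
proof -
  obtain pt where pt: "pointed_D_set I r D M E P pt" "\<forall>a\<in>per_dom (E i). Pt i a = pt i a"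
    using PER_set assms(1) unfolding PER_set_def by blast
  have "(a, pt i a) \<in> E i"
    using pt(1) assms unfolding pointed_D_set_def by blast
  then show ?thesis
    using pt(2) rel_refl[OF assms] Pt_eq[OF assms] by (simp add: per_dom_def)
qed

lemma Pt_mem: "i \<in> I \<Longrightarrow> a \<in> M \<Longrightarrow> Pt i a \<in> P i"
  using PER_set unfolding PER_set_def by blast

lemma P_subset: "i \<in> I \<Longrightarrow> P i \<subseteq> M"
  using PER_set unfolding PER_set_def pointed_D_set_def by blast

lemma Pt_carrier: "i \<in> I \<Longrightarrow> a \<in> M \<Longrightarrow> Pt i a \<in> M"
  using Pt_mem P_subset by blast

lemma P_eq_image: "i \<in> I \<Longrightarrow> P i = Pt i ` per_dom (E i)"
proof -
  assume i: "i \<in> I"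
  obtain pt where pt: "pointed_D_set I r D M E P pt" "\<forall>a\<in>per_dom (E i). Pt i a = pt i a"
    using PER_set i unfolding PER_set_def by blast
  have "P i = pt i ` per_dom (E i)"
    using pt(1) i unfolding pointed_D_set_def by blast
  also have "\<dots> = Pt i ` per_dom (E i)"
    using pt(2) by (simp cong: image_cong)
  finally show ?thesis .
qed

text \<open>A point has the form \<open>Pt i a\<close> with \<open>a\<close> in \<open>[i]\<close>,
  and such an \<open>a\<close> is related to \<open>Pt i a\<close>.\<close>

lemma P_refl:
  assumes "i \<in> I" "p \<in> P i"
  shows "(p, p) \<in> E i"
  using assms rel_Pt rel_refl(2) unfolding P_eq_image[OF assms(1)] per_dom_def by blast

lemma Pt_refl: "i \<in> I \<Longrightarrow> a \<in> M \<Longrightarrow> (Pt i a, Pt i a) \<in> E i"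
  by (simp add: P_refl Pt_mem)

text \<open>Write \<open>p = Pt i a\<close> with \<open>a\<close> in \<open>[i]\<close>. Then
  \<open>a\<close> and \<open>p\<close> are related, so \<open>Pt i\<close> takes the same value at
  both, and at \<open>a\<close> that value is \<open>p\<close>.\<close>

lemma Pt_fixes_P:
  assumes "i \<in> I" "p \<in> P i"
  shows "Pt i p = p"
proof -
  obtain a where a: "p = Pt i a" "(a, a) \<in> E i"
    using assms unfolding P_eq_image[OF assms(1)] per_dom_def by blast
  then show ?thesis
    using Pt_eq[OF assms(1) rel_Pt[OF assms(1) a(2)]] by simp
qed

lemma P_mono: "i \<in> I \<Longrightarrow> i' \<in> I \<Longrightarrow> (i, i') \<in> r \<Longrightarrow> P i \<subseteq> P i'"
  using PER_set unfolding PER_set_def pointed_D_set_def by blast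

lemma Pt_Pt: "i \<in> I \<Longrightarrow> i' \<in> I \<Longrightarrow> (i, i') \<in> r \<Longrightarrow> a \<in> M \<Longrightarrow> Pt i (Pt i' a) = Pt i a"
  using PER_set unfolding PER_set_def by metis

lemma Pt_idem: "i \<in> I \<Longrightarrow> a \<in> M \<Longrightarrow> Pt i (Pt i a) = Pt i a"
  by (simp add: Pt_fixes_P Pt_mem)

text \<open>The point \<open>Pt i a\<close> is also a point at the larger index \<open>i'\<close>,
  where \<open>Pt i'\<close> fixes it. Together with \<open>Pt_Pt\<close> this shows that the two
  maps compose to the smaller one in either order.\<close>

lemma Pt_Pt':
  assumes "i \<in> I" "i' \<in> I" "(i, i') \<in> r" "a \<in> M"
  shows "Pt i' (Pt i a) = Pt i a"
  using assms P_mono Pt_fixes_P Pt_mem by blast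

lemma Pt_eq_downward:
  assumes "i \<in> I" "i' \<in> I" "(i, i') \<in> r" "a \<in> M" "b \<in> M" "Pt i' a = Pt i' b"
  shows "Pt i a = Pt i b"
  using assms Pt_Pt by metis

lemma rel_iff_Pt:
  assumes "i \<in> I" "(a, a) \<in> E i" "(b, b) \<in> E i"
  shows "(a, b) \<in> E i \<longleftrightarrow> Pt i a = Pt i b"
  using assms by (metis Pt_eq rel_Pt rel_sym rel_trans)

text \<open>Passing to points at a larger index preserves the finer information at \<open>i\<close>:
  the images stay in \<open>[i]\<close>, and there \<open>Pt i\<close>, which absorbs
  \<open>Pt i'\<close>, decides whether they are related.\<close>

lemma rel_Pt_Pt:
  assumes "i \<in> I" "i' \<in> I" "(i, i') \<in> r" "(a, b) \<in> E i"
  shows "(Pt i' a, Pt i' b) \<in> E i"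
proof -
  have dom: "(Pt i' c, Pt i' c) \<in> E i" if "(c, c) \<in> E i" for c
    using PER_set assms that unfolding PER_set_def per_dom_def by blast
  have "Pt i (Pt i' a) = Pt i (Pt i' b)"
    using Pt_eq[OF assms(1,4)] Pt_Pt[OF assms(1-3)] rel_carrier[OF assms(1,4)] by simp
  then show ?thesis
    using rel_iff_Pt[OF assms(1) dom dom] rel_refl[OF assms(1,4)] by blast
qed

text \<open>Distinct points lie in distinct classes, since \<open>Pt i\<close> is constant on
  classes and fixes points. So the finitely many classes bound the number of points.\<close>

lemma finite_P:
  assumes "i \<in> I"
  shows "finite (P i)"
proof -
  have fin: "finite (per_dom (E i) // E i)"
    using D_set assms by (simp add: D_set_def)
  have "inj_on (\<lambda>p. E i `` {p}) (P i)"
  proof (rule inj_onI)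
    fix p q assume pq: "p \<in> P i" "q \<in> P i" "E i `` {p} = E i `` {q}"
    then have "(p, q) \<in> E i"
      using P_refl[OF assms] by blast
    then show "p = q"
      using Pt_eq[OF assms] Pt_fixes_P[OF assms] pq by metis
  qed
  moreover have "(\<lambda>p. E i `` {p}) ` P i \<subseteq> per_dom (E i) // E i"
    using P_refl[OF assms] by (auto simp: per_dom_def intro: quotientI)
  ultimately show ?thesis
    using fin finite_imageD finite_subset by blast
qed

end

text \<open>The total map \<open>Pt\<close> itself serves as the witness for \<open>pt\<close>, so
  only conditions on \<open>Pt\<close> remain to be checked.\<close>

lemma PER_setI:
  assumes "D_set I r D M E"
    and "\<And>i. i \<in> I \<Longrightarrow> P i \<subseteq> M"
    and "\<And>i a. i \<in> I \<Longrightarrow> a \<in> M \<Longrightarrow> Pt i a \<in> P i"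
    and "\<And>i a. i \<in> I \<Longrightarrow> a \<in> P i \<Longrightarrow> (a, a) \<in> E i \<and> Pt i a = a"
    and "\<And>i a b. i \<in> I \<Longrightarrow> (a, b) \<in> E i \<Longrightarrow> (a, Pt i a) \<in> E i \<and> Pt i a = Pt i b"
    and "\<And>i i'. i \<in> I \<Longrightarrow> i' \<in> I \<Longrightarrow> (i, i') \<in> r \<Longrightarrow> P i \<subseteq> P i'"
    and "\<And>i i' a. i \<in> I \<Longrightarrow> i' \<in> I \<Longrightarrow> (i, i') \<in> r \<Longrightarrow> a \<in> M \<Longrightarrow> Pt i (Pt i' a) = Pt i a"
    and "\<And>i i' a. i \<in> I \<Longrightarrow> i' \<in> I \<Longrightarrow> (i, i') \<in> r \<Longrightarrow> (a, a) \<in> E i \<Longrightarrow> (Pt i' a, Pt i' a) \<in> E i"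
  shows "PER_set I r D M E P Pt"
proof -
  have "per_dom (E i) \<subseteq> M" if "i \<in> I" for i
    using assms(1) that unfolding D_set_def per_dom_def by blast
  \<comment> \<open>Surjectivity: each point lies in \<open>[i]\<close> and is fixed by
    \<open>Pt i\<close>, so it is its own preimage.\<close>
  then have "Pt i ` per_dom (E i) = P i" if "i \<in> I" for i
    using assms(3,4) that unfolding per_dom_def by (force simp: image_iff)
  then have "\<forall>i\<in>I. P i \<subseteq> M \<and> Pt i ` per_dom (E i) = P i"
    using assms(2) by blast
  moreover have "\<forall>i\<in>I. \<forall>a b. (a, b) \<in> E i \<longrightarrow> (a, Pt i a) \<in> E i \<and> Pt i a = Pt i b"
    using assms(5) by blast
  moreover have "\<forall>i\<in>I. \<forall>i'\<in>I. (i, i') \<in> r \<longrightarrow> P i \<subseteq> P i' \<and>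
      (\<forall>a. a \<in> per_dom (E i) \<inter> per_dom (E i') \<longrightarrow> Pt i' a \<in> per_dom (E i))"
    using assms(6,8) by (simp add: per_dom_def)
  ultimately have "pointed_D_set I r D M E P Pt"
    unfolding pointed_D_set_def using assms(1) by (intro conjI)
  moreover have "\<forall>i\<in>I. Pt i \<in> M \<rightarrow> P i \<and> (\<forall>a\<in>per_dom (E i). Pt i a = Pt i a)"
    using assms(3) by blast
  moreover have "\<forall>i\<in>I. \<forall>i'\<in>I. (i, i') \<in> r \<longrightarrow> (\<forall>a\<in>M. Pt i a = Pt i (Pt i' a)) \<and>
      (\<forall>a\<in>per_dom (E i). Pt i' a \<in> per_dom (E i))"
    using assms(7)[symmetric] assms(8) unfolding per_dom_def by (intro ballI impI conjI) simp_all
  ultimately show ?thesis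
    unfolding PER_set_def by (intro exI conjI)
qed

section \<open>The function space as a \<open>D_set\<close>\<close>

locale per_set_pair = M: per_set I r DI M E P Pt + N: per_set J s DJ N F Q Qt
  for I :: "'i set" and r DI
    and M :: "'a set" and E P Pt
    and J :: "'j set" and s DJ
    and N :: "'b set" and F Q Qt +
  fixes DIJ :: "('i \<times> 'j) set set"
  assumes filter: "D_filter (I \<times> J) (prod_order r s) DIJ"
begin

abbreviation "C \<equiv> D_fun_space I J DIJ M E N F"
abbreviation "R \<equiv> D_fun_approx I J DIJ M E N F"

lemma mem_C_iff:
  "f \<in> C \<longleftrightarrow> f \<in> M \<rightarrow>\<^sub>E N \<and> {ij \<in> I \<times> J. (f, f) \<in> fun_approx M E N F ij} \<in> DIJ"
  by (simp add: D_fun_space_def D_continuous_def)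

lemma C_app: "f \<in> C \<Longrightarrow> a \<in> M \<Longrightarrow> f a \<in> N"
  by (auto simp: mem_C_iff)

lemma R_D:
  assumes "i \<in> I" "(f, g) \<in> R (i, j)" "(a, b) \<in> E i"
  shows "(f a, g b) \<in> F j"
  using assms M.rel_carrier[OF assms(1,3)] by (auto simp: D_fun_approx_def fun_approx_def)

lemma R_carrier: "(f, g) \<in> R ij \<Longrightarrow> f \<in> C \<and> g \<in> C"
  by (auto simp: D_fun_approx_def)

lemma R_I:
  assumes "f \<in> C" "g \<in> C" "\<And>a b. (a, b) \<in> E i \<Longrightarrow> (f a, g b) \<in> F j"
  shows "(f, g) \<in> R (i, j)"
  using assms by (auto simp: D_fun_approx_def fun_approx_def mem_C_iff)

lemma sym_R:
  assumes "i \<in> I" "j \<in> J"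
  shows "sym (R (i, j))"
proof (rule symI)
  fix f g assume fg: "(f, g) \<in> R (i, j)"
  show "(g, f) \<in> R (i, j)"
    using R_carrier[OF fg] R_D[OF assms(1) fg] M.rel_sym[OF assms(1)] N.rel_sym[OF assms(2)]
    by (intro R_I) blast+
qed

lemma trans_R:
  assumes "i \<in> I" "j \<in> J"
  shows "trans (R (i, j))"
proof (rule transI)
  fix f g h assume fg: "(f, g) \<in> R (i, j)" and gh: "(g, h) \<in> R (i, j)"
  show "(f, h) \<in> R (i, j)"
  proof (rule R_I)
    fix a b assume ab: "(a, b) \<in> E i"
    \<comment> \<open>The second relation is applied to the pair \<open>(b, b)\<close>, so that
      \<open>g b\<close> is the middle term.\<close>
    show "(f a, h b) \<in> F j"
      using R_D[OF assms(1) fg ab] R_D[OF assms(1) gh M.rel_refl(2)[OF assms(1) ab]]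
        N.rel_trans[OF assms(2)] by blast
  qed (use R_carrier fg gh in blast)+
qed

text \<open>Both functions respect the passage from an argument to its point, which gives the chain
  \<open>f a\<close>, \<open>f (Pt i b)\<close>, \<open>g (Pt i b)\<close>,
  \<open>g b\<close>.\<close>

lemma R_if_points:
  assumes ij: "i \<in> I" "j \<in> J" and f: "(f, f) \<in> R (i, j)" and g: "(g, g) \<in> R (i, j)"
    and fg: "\<And>p. p \<in> P i \<Longrightarrow> (f p, g p) \<in> F j"
  shows "(f, g) \<in> R (i, j)"
proof (rule R_I)
  fix a b assume ab: "(a, b) \<in> E i"
  have "(f a, f (Pt i b)) \<in> F j"
    by (rule R_D[OF ij(1) f M.rel_Pt[OF ij(1) ab]])
  moreover have "(f (Pt i b), g (Pt i b)) \<in> F j"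
    using fg M.Pt_mem M.rel_carrier(2)[OF ij(1) ab] ij by blast
  moreover have "(g (Pt i b), g b) \<in> F j"
    by (rule R_D[OF ij(1) g M.rel_sym[OF ij(1) M.rel_Pt[OF ij(1) M.rel_refl(2)[OF ij(1) ab]]]])
  ultimately show "(f a, g b) \<in> F j"
    using N.rel_trans[OF ij(2)] by blast
qed (use R_carrier f g in blast)+

text \<open>A pair related at \<open>i\<close> need not be related at \<open>i'\<close>, so the
  hypothesis at \<open>i'\<close> cannot be used on arbitrary arguments. Points at \<open>i\<close>
  are reflexive at both indices, and testing on them suffices.\<close>

lemma R_downward:
  assumes ij: "i \<in> I" "j \<in> J" "i' \<in> I" "j' \<in> J" "(i, i') \<in> r" "(j, j') \<in> s"
    and fg: "(f, g) \<in> R (i', j')" and f: "(f, f) \<in> R (i, j)" and g: "(g, g) \<in> R (i, j)"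
  shows "(f, g) \<in> R (i, j)"
proof (rule R_if_points[OF ij(1,2) f g])
  fix p assume p: "p \<in> P i"
  have "(p, p) \<in> E i" and "(p, p) \<in> E i'"
    using p ij M.P_refl M.P_mono by blast+
  \<comment> \<open>The values are related at \<open>j'\<close>. Both lie in \<open>[j]\<close>
    because \<open>f\<close> and \<open>g\<close> are reflexive at \<open>(i, j)\<close>, so the
    relation descends to \<open>j\<close>.\<close>
  then show "(f p, g p) \<in> F j"
    using ij f g fg R_D N.rel_downward by metis
qed

text \<open>The table \<open>\<Phi> f\<close> records, for each point at \<open>i\<close>, which
  point at \<open>j\<close> represents the value of \<open>f\<close>. Functions with equal tables
  are related, and there are only finitely many tables.\<close>

lemma finite_R_classes:
  assumes ij: "i \<in> I" "j \<in> J"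
  shows "finite (per_dom (R (i, j)) // R (i, j))"
proof -
  define \<Phi> where "\<Phi> = (\<lambda>f. restrict (Qt j \<circ> f) (P i))"
  define A where "A = per_dom (R (i, j))"
  have AC: "f \<in> C" if "f \<in> A" for f
    using that R_carrier unfolding A_def per_dom_def by blast
  have rel: "(f, g) \<in> R (i, j)" if "f \<in> A" "g \<in> A" "\<Phi> f = \<Phi> g" for f g
  proof (rule R_if_points[OF ij])
    show f: "(f, f) \<in> R (i, j)" and g: "(g, g) \<in> R (i, j)"
      using that by (auto simp: A_def per_dom_def)
    fix p assume p: "p \<in> P i"
    have "Qt j (f p) = Qt j (g p)"
      using fun_cong[OF that(3), of p] p by (simp add: \<Phi>_def)
    moreover have "(f p, f p) \<in> F j" "(g p, g p) \<in> F j"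
      using R_D f g ij M.P_refl[OF ij(1) p] by blast+
    ultimately show "(f p, g p) \<in> F j"
      by (simp add: N.rel_iff_Pt ij)
  qed
  have "\<Phi> ` A \<subseteq> P i \<rightarrow>\<^sub>E Q j"
    using AC C_app N.Pt_mem[OF ij(2)] M.P_subset[OF ij(1)] by (fastforce simp: \<Phi>_def)
  then have "finite (\<Phi> ` A)"
    using M.finite_P N.finite_P ij by (meson finite_PiE finite_subset)
  \<comment> \<open>\<open>inv_into\<close> picks one function per table, and the classes of these
    chosen functions exhaust the quotient.\<close>
  moreover have "A // R (i, j) \<subseteq> (\<lambda>\<phi>. R (i, j) `` {inv_into A \<Phi> \<phi>}) ` (\<Phi> ` A)"
  proof
    fix X assume "X \<in> A // R (i, j)"
    then obtain f where f: "f \<in> A" "X = R (i, j) `` {f}"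
      by (auto elim: quotientE)
    define g where "g = inv_into A \<Phi> (\<Phi> f)"
    have g: "g \<in> A" "\<Phi> g = \<Phi> f"
      using f by (auto simp: g_def inv_into_into f_inv_into_f)
    have "R (i, j) `` {f} = R (i, j) `` {g}"
      using rel[of f g] rel[of g f] f g transD[OF trans_R[OF ij]] by auto
    then show "X \<in> (\<lambda>\<phi>. R (i, j) `` {inv_into A \<Phi> \<phi>}) ` (\<Phi> ` A)"
      using f by (auto simp: g_def)
  qed
  ultimately show ?thesis
    unfolding A_def by (meson finite_imageI finite_subset)
qed

lemma D_set_fun_space: "D_set (I \<times> J) (prod_order r s) DIJ C R"
proof -
  \<comment> \<open>This is the continuity of \<open>f\<close> itself, read as a property of the
    index set attached to \<open>f\<close>.\<close>
  have "{ij \<in> I \<times> J. f \<in> per_dom (R ij)} \<in> DIJ" if "f \<in> C" for f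
    using that by (simp add: per_dom_def D_fun_approx_def mem_C_iff)
  moreover have "R ij \<subseteq> C \<times> C" for ij
    by (auto simp: D_fun_approx_def)
  moreover have "sym (R ij) \<and> trans (R ij) \<and> finite (per_dom (R ij) // R ij)"
    if "ij \<in> I \<times> J" for ij
    using that sym_R trans_R finite_R_classes by (cases ij) simp
  moreover have "(f, g) \<in> R ij"
    if "ij \<in> I \<times> J" "kl \<in> I \<times> J" "(ij, kl) \<in> prod_order r s"
      "(f, g) \<in> R kl" "(f, f) \<in> R ij" "(g, g) \<in> R ij" for ij kl f g
  proof -
    obtain i j k l where "ij = (i, j)" "kl = (k, l)"
      by fastforce
    then show ?thesis
      using that R_downward[of i j k l f g] by (simp add: prod_order_def)
  qed
  ultimately show ?thesis
    using index_set_prod[OF M.index_set N.index_set]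
    unfolding D_set_def per_dom_def mem_Collect_eq by (intro conjI ballI allI impI) blast+
qed

section \<open>Points of the function space\<close>

lemma fun_points_iff:
  "f \<in> fun_points M Pt N Q (i, j) \<longleftrightarrow>
     f \<in> M \<rightarrow>\<^sub>E N \<and> (\<forall>a\<in>M. \<forall>b\<in>M. Pt i a = Pt i b \<longrightarrow> f a = f b \<and> f b \<in> Q j)"
  by (auto simp: fun_points_def approx_plus_def)

text \<open>A larger \<open>i'\<close> makes \<open>Pt i'\<close> identify fewer arguments, which
  weakens the condition on \<open>f\<close>; a larger \<open>j'\<close> admits more values.\<close>

lemma fun_points_mono:
  assumes "i \<in> I" "j \<in> J" "i' \<in> I" "j' \<in> J" "(i, i') \<in> r" "(j, j') \<in> s"
  shows "fun_points M Pt N Q (i, j) \<subseteq> fun_points M Pt N Q (i', j')"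
proof
  fix f assume f: "f \<in> fun_points M Pt N Q (i, j)"
  have "Q j \<subseteq> Q j'"
    using assms N.P_mono by blast
  moreover have "Pt i a = Pt i b" if "a \<in> M" "b \<in> M" "Pt i' a = Pt i' b" for a b
    using M.Pt_eq_downward assms that by blast
  ultimately show "f \<in> fun_points M Pt N Q (i', j')"
    using f unfolding fun_points_iff by blast
qed

text \<open>Related arguments have the same point, so \<open>f\<close> sends them to one and the
  same element of \<open>Q j\<close>, and points are reflexive.\<close>

lemma fun_points_refl:
  assumes "i \<in> I" "j \<in> J" "f \<in> fun_points M Pt N Q (i, j)"
  shows "(f, f) \<in> fun_approx M E N F (i, j)"
proof -
  have "(f a, f b) \<in> F j" if "a \<in> M" "b \<in> M" "(a, b) \<in> E i" for a b
  proof -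
    have "f a = f b" "f b \<in> Q j"
      using assms(3) that M.Pt_eq[OF assms(1) that(3)] unfolding fun_points_iff by blast+
    then show ?thesis
      using N.P_refl[OF assms(2)] by simp
  qed
  moreover have "f \<in> M \<rightarrow>\<^sub>E N"
    using assms(3) unfolding fun_points_iff by blast
  ultimately show ?thesis
    by (simp add: fun_approx_def)
qed

lemma fun_points_subset:
  assumes ij: "i \<in> I" "j \<in> J"
  shows "fun_points M Pt N Q (i, j) \<subseteq> C"
proof
  fix f assume f: "f \<in> fun_points M Pt N Q (i, j)"
  \<comment> \<open>The principal up-set at \<open>(i, j)\<close>: by monotonicity \<open>f\<close>
    is a point, hence reflexive, at each of its indices. Non-empty up-sets belong to the
    filter.\<close>
  let ?U = "{ij' \<in> I \<times> J. ((i, j), ij') \<in> prod_order r s}"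
  have "up_set (I \<times> J) (prod_order r s) ?U"
    unfolding up_set_def prod_order_def by (auto intro: M.order_trans N.order_trans)
  moreover have "?U \<noteq> {}"
    using ij M.order_refl N.order_refl by (auto simp: prod_order_def)
  moreover have "?U \<subseteq> {ij' \<in> I \<times> J. (f, f) \<in> fun_approx M E N F ij'}"
    using f ij fun_points_mono fun_points_refl unfolding prod_order_def by fast
  ultimately have "{ij' \<in> I \<times> J. (f, f) \<in> fun_approx M E N F ij'} \<in> DIJ"
    by (rule D_filterI_up_set[OF filter]) auto
  then show "f \<in> C"
    using f by (simp add: mem_C_iff fun_points_iff)
qed

section \<open>The maps onto the points\<close>

lemma fun_Pt_app: "a \<in> M \<Longrightarrow> fun_Pt M Pt Qt (i, j) f a = Qt j (f (Pt i a))"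
  by (simp add: fun_Pt_def)

lemma fun_Pt_eqI:
  assumes "\<And>a. a \<in> M \<Longrightarrow> Qt j (f (Pt i a)) = Qt j (g (Pt i a))"
  shows "fun_Pt M Pt Qt (i, j) f = fun_Pt M Pt Qt (i, j) g"
  using assms by (auto simp: fun_Pt_def fun_eq_iff restrict_def)

text \<open>The argument enters only through \<open>Pt i\<close>, so arguments with the same point
  get the same value, and the outer \<open>Qt j\<close> puts that value into
  \<open>Q j\<close>.\<close>

lemma fun_Pt_mem:
  assumes ij: "i \<in> I" "j \<in> J" and "f \<in> C"
  shows "fun_Pt M Pt Qt (i, j) f \<in> fun_points M Pt N Q (i, j)"
proof -
  have "Qt j (f (Pt i a)) \<in> Q j" if "a \<in> M" for a
    using assms that C_app M.Pt_carrier N.Pt_mem by blast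
  then have "fun_Pt M Pt Qt (i, j) f \<in> M \<rightarrow>\<^sub>E N"
    using N.P_subset[OF ij(2)] by (auto simp: fun_Pt_def)
  then show ?thesis
    using \<open>\<And>a. a \<in> M \<Longrightarrow> Qt j (f (Pt i a)) \<in> Q j\<close> by (simp add: fun_points_iff fun_Pt_app)
qed

lemma fun_Pt_C: "i \<in> I \<Longrightarrow> j \<in> J \<Longrightarrow> f \<in> C \<Longrightarrow> fun_Pt M Pt Qt (i, j) f \<in> C"
  using fun_Pt_mem fun_points_subset by blast

text \<open>By idempotence \<open>a\<close> and \<open>Pt i a\<close> have the same point, so
  \<open>f\<close> does not distinguish them. The common value lies in \<open>Q j\<close> and is
  fixed by \<open>Qt j\<close>.\<close>

lemma fun_Pt_fixes_points:
  assumes ij: "i \<in> I" "j \<in> J" and f: "f \<in> fun_points M Pt N Q (i, j)"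
  shows "fun_Pt M Pt Qt (i, j) f = f"
proof (rule extensionalityI)
  show "fun_Pt M Pt Qt (i, j) f \<in> extensional M"
    by (simp add: fun_Pt_def)
  show "f \<in> extensional M"
    using f by (auto simp: fun_points_iff PiE_def)
  fix a assume a: "a \<in> M"
  have "f (Pt i a) = f a" "f a \<in> Q j"
    using f a M.Pt_carrier[OF ij(1) a] M.Pt_idem[OF ij(1) a] unfolding fun_points_iff by blast+
  then show "fun_Pt M Pt Qt (i, j) f a = f a"
    using a ij by (simp add: fun_Pt_app N.Pt_fixes_P)
qed

lemma R_fun_Pt:
  assumes ij: "i \<in> I" "j \<in> J" and fg: "(f, g) \<in> R (i, j)"
  shows "(f, fun_Pt M Pt Qt (i, j) f) \<in> R (i, j)"
    and "fun_Pt M Pt Qt (i, j) f = fun_Pt M Pt Qt (i, j) g"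
proof -
  have ff: "(f, f) \<in> R (i, j)"
    using fg symD[OF sym_R[OF ij]] transD[OF trans_R[OF ij]] by blast
  show "(f, fun_Pt M Pt Qt (i, j) f) \<in> R (i, j)"
  proof (rule R_I)
    fix a b assume ab: "(a, b) \<in> E i"
    \<comment> \<open>Two replacements by points: \<open>b\<close> by \<open>Pt i b\<close> under
      \<open>f\<close>, then the value by its image under \<open>Qt j\<close>.\<close>
    show "(f a, fun_Pt M Pt Qt (i, j) f b) \<in> F j"
      using N.rel_Pt[OF ij(2) R_D[OF ij(1) ff M.rel_Pt[OF ij(1) ab]]] M.rel_carrier[OF ij(1) ab]
      by (simp add: fun_Pt_app)
  qed (use R_carrier[OF fg] fun_Pt_C ij in blast)+
  show "fun_Pt M Pt Qt (i, j) f = fun_Pt M Pt Qt (i, j) g"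
    using N.Pt_eq[OF ij(2) R_D[OF ij(1) fg M.Pt_refl[OF ij(1)]]] by (rule fun_Pt_eqI)
qed

text \<open>On the argument side \<open>Pt i\<close> is applied first, so \<open>Pt i'\<close> meets
  a point that it fixes. On the value side \<open>Qt j\<close> absorbs \<open>Qt j'\<close>.\<close>

lemma fun_Pt_fun_Pt:
  assumes "i \<in> I" "j \<in> J" "i' \<in> I" "j' \<in> J" "(i, i') \<in> r" "(j, j') \<in> s" "f \<in> C"
  shows "fun_Pt M Pt Qt (i, j) (fun_Pt M Pt Qt (i', j') f) = fun_Pt M Pt Qt (i, j) f"
  using assms by (intro fun_Pt_eqI) (simp add: fun_Pt_app M.Pt_carrier M.Pt_Pt' N.Pt_Pt C_app)

text \<open>All three factors preserve relatedness at the lower indices: \<open>Pt i'\<close>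
  preserves \<open>E i\<close>, \<open>f\<close> carries \<open>E i\<close> to \<open>F j\<close>,
  and \<open>Qt j'\<close> preserves \<open>F j\<close>.\<close>

lemma fun_Pt_refl_above:
  assumes ij: "i \<in> I" "j \<in> J" "i' \<in> I" "j' \<in> J" "(i, i') \<in> r" "(j, j') \<in> s"
    and f: "(f, f) \<in> R (i, j)"
  shows "(fun_Pt M Pt Qt (i', j') f, fun_Pt M Pt Qt (i', j') f) \<in> R (i, j)"
proof (rule R_I)
  fix a b assume ab: "(a, b) \<in> E i"
  have "(f (Pt i' a), f (Pt i' b)) \<in> F j"
    by (rule R_D[OF ij(1) f M.rel_Pt_Pt[OF ij(1,3,5) ab]])
  then show "(fun_Pt M Pt Qt (i', j') f a, fun_Pt M Pt Qt (i', j') f b) \<in> F j"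
    using N.rel_Pt_Pt[OF ij(2,4,6)] M.rel_carrier[OF ij(1) ab] by (simp add: fun_Pt_app)
qed (use R_carrier[OF f] fun_Pt_C ij in blast)+

lemma PER_set_fun_space:
  "PER_set (I \<times> J) (prod_order r s) DIJ C R (fun_points M Pt N Q) (fun_Pt M Pt Qt)"
proof (rule PER_setI[OF D_set_fun_space])
  fix p f assume "p \<in> I \<times> J" "f \<in> fun_points M Pt N Q p"
  then show "(f, f) \<in> R p \<and> fun_Pt M Pt Qt p f = f"
    using fun_points_refl fun_points_subset fun_Pt_fixes_points by (fastforce simp: D_fun_approx_def)
next
  fix p q assume "p \<in> I \<times> J" "q \<in> I \<times> J" "(p, q) \<in> prod_order r s"
  then show "fun_points M Pt N Q p \<subseteq> fun_points M Pt N Q q"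
    using fun_points_mono by (cases p, cases q) (simp add: prod_order_def)
next
  fix p q f assume "p \<in> I \<times> J" "q \<in> I \<times> J" "(p, q) \<in> prod_order r s" "f \<in> C"
  then show "fun_Pt M Pt Qt p (fun_Pt M Pt Qt q f) = fun_Pt M Pt Qt p f"
    using fun_Pt_fun_Pt by (cases p, cases q) (simp add: prod_order_def)
next
  fix p q f assume "p \<in> I \<times> J" "q \<in> I \<times> J" "(p, q) \<in> prod_order r s" "(f, f) \<in> R p"
  then show "(fun_Pt M Pt Qt q f, fun_Pt M Pt Qt q f) \<in> R p"
    using fun_Pt_refl_above by (cases p, cases q) (simp add: prod_order_def)
next
  fix p f g assume "p \<in> I \<times> J" "(f, g) \<in> R p"
  then show "(f, fun_Pt M Pt Qt p f) \<in> R p \<and> fun_Pt M Pt Qt p f = fun_Pt M Pt Qt p g"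
    using R_fun_Pt by (cases p) blast
next
  fix p f assume "p \<in> I \<times> J" "f \<in> C"
  then show "fun_Pt M Pt Qt p f \<in> fun_points M Pt N Q p"
    using fun_Pt_mem by (cases p) simp
next
  fix p assume "p \<in> I \<times> J"
  then show "fun_points M Pt N Q p \<subseteq> C"
    using fun_points_subset by (cases p) simp
qed

end

theorem proposition4p6:
  fixes I :: "'i set" and r :: "'i rel" and DI :: "'i set set"
    and J :: "'j set" and s :: "'j rel" and DJ :: "'j set set"
    and DIJ :: "('i \<times> 'j) set set"
    and M :: "'a set" and E :: "'i \<Rightarrow> 'a rel" and P :: "'i \<Rightarrow> 'a set" and Pt :: "'i \<Rightarrow> 'a \<Rightarrow> 'a"
    and N :: "'b set" and F :: "'j \<Rightarrow> 'b rel" and Q :: "'j \<Rightarrow> 'b set" and Qt :: "'j \<Rightarrow> 'b \<Rightarrow> 'b"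
  assumes "D_filter I r DI"
    and "D_filter J s DJ"
    and "D_filter (I \<times> J) (prod_order r s) DIJ"
    and "D_projection DI J DJ DIJ"
    and "PER_set I r DI M E P Pt"
    and "PER_set J s DJ N F Q Qt"
  shows "PER_set (I \<times> J) (prod_order r s) DIJ
           (D_fun_space I J DIJ M E N F)
           (D_fun_approx I J DIJ M E N F)
           (fun_points M Pt N Q)
           (fun_Pt M Pt Qt)"
proof -
  interpret per_set_pair I r DI M E P Pt J s DJ N F Q Qt DIJ
    using assms(3,5,6) by unfold_locales
  show ?thesis
    by (rule PER_set_fun_space)
qed

end
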